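(* Fix a gain $\Lambda\in\mathbb{R}^m$, a gauge $K\in\mathbb{R}^{N\times N^2}$ satisfying $K(\mathbf w\otimes\mathbf w)\equiv0$, and a matrix $\widehat P=\widehat P^{\top}\succ0$. Let $\widehat J$ be assembled from $\widehat P$ and the representation $H(\Lambda)+K$ as described in the context. Suppose that real numbers $\widehat\delta,\widehat j$ satisfy $$\lVert A(\Lambda)^{\top}\widehat P+\widehat PA(\Lambda)+I_N\rVert\le\widehat\delta<1,\qquad\lVert\widehat J\rVert\le\widehat j.$$ For $\eta\in(0,1)$ and $\widehat j>0$, put $\rho_{\mathrm{safe}}:=(1-\eta)(1-\widehat\delta)/\widehat j$. Then the ellipsoid $\{\mathbf w\in\mathbb{R}^N:\mathbf w^{\top}\widehat P\mathbf w\le\rho_{\mathrm{safe}}^2\}$ is positively invariant for $\dot{\mathbf w}=\mathbf F_\Lambda(\mathbf w)$ and contained in the region of attraction of the origin of this system; and its pullback $\{\mathbf x\in\mathbb{R}^n:\Phi(\mathbf x)^{\top}\widehat P\Phi(\mathbf x)\le\rho_{\mathrm{safe}}^2\}$ is contained in the region of attraction of the origin of $\dot{\mathbf x}=\mathbf p(\mathbf x)$. If $\widehat j=0$, then $\mathbf w^{\top}\widehat P\mathbf w$ is a global Lyapunov function for $\dot{\mathbf w}=\mathbf F_\Lambda(\mathbf w)$.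
   Context: Polynomial system: $\dot{\mathbf x}=\mathbf p(\mathbf x)$ with $\mathbf p\in\mathbb{R}[\mathbf x]^n$, $\mathbf p(\mathbf 0)=\mathbf 0$, and the standing assumption that the Jacobian $J_x(\mathbf p)|_{\mathbf 0}$ is Hurwitz (all eigenvalues have negative real part). $\lVert\cdot\rVert$ is the spectral norm. Fixed lift: $m\ge0$, $N=n+m$, $\mathbf g=(g_1,\dots,g_m)$ with each $g_i$ a monomial in $\mathbf x$ of degree at least $2$; $\Phi(\mathbf x)=(\mathbf x,\mathbf g(\mathbf x))\in\mathbb{R}^N$; coordinates $\mathbf w=(\mathbf x,\mathbf y)$. The lift is inner-quadratic: for each $i$ a factorization $g_i=a_ib_i$ is fixed, with $a_i,b_i\in\{x_1,\dots,x_n,y_1,\dots,y_{i-1}\}$ (the identity holding after substituting $\mathbf y=\mathbf g(\mathbf x)$). Stabilizers: $h_i=y_i-a_ib_i$. Reference extension: $\mathbf F_0(\mathbf w)=A_0\mathbf w+H_0(\mathbf w\otimes\mathbf w)$, a vector field on $\mathbb{R}^N$ with polynomial components of total degree at most two, satisfying $\mathbf F_0(\Phi(\mathbf x))=J_x(\Phi)(\mathbf x)\mathbf p(\mathbf x)$ for all $\mathbf x$. Stabilized family: for $\Lambda\in\mathbb{R}^m$, $\mathbf F_\Lambda=\mathbf F_0-\sum_i\lambda_i\mathbf e_{n+i}h_i=A(\Lambda)\mathbf w+H(\Lambda)(\mathbf w\otimes\mathbf w)$ with $A(\Lambda)=A_0-\sum_i\lambda_i\mathbf e_{n+i}\mathbf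 e_{n+i}^{\top}$, $H(\Lambda)=H_0+\sum_i\lambda_i\mathbf e_{n+i}s_i^{\top}$, where $s_i\in\mathbb{R}^{N^2}$ satisfies $s_i^{\top}(\mathbf w\otimes\mathbf w)=a_ib_i$. Assembly of $\widehat J$: factor $\widehat P=\widehat P_f^{\top}\widehat P_f$; with blocks $(M_i)_{rj}:=(H(\Lambda)+K)_{r,(i-1)N+j}$, let $\widehat G\in\mathbb{R}^{N^2\times N}$ be the vertical stacking of $M_i^{\top}\widehat P+\widehat PM_i$, $i=1,\dots,N$, and $\widehat J:=(\widehat P_f^{\top}\otimes I_N)^{-1}\widehat G$ (its norm does not depend on the factor). The region of attraction of the origin is the set of initial states whose trajectories exist for all $t\ge0$ and converge to the origin. A positive definite quadratic form is a global Lyapunov function if its derivative along the system is negative at every nonzero $\mathbf w$. *)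

theory Defs
  imports "HOL-Analysis.Analysis"
begin

section \<open>Matrices\<close>

definition spectral_norm :: "real^'n^'m \<Rightarrow> real" where
  "spectral_norm A = onorm ((*v) A)"

definition hurwitz :: "real^'n^'n \<Rightarrow> bool" where
  "hurwitz A \<longleftrightarrow>
     (\<forall>(\<mu>::complex) (v::complex^'n).
        v \<noteq> 0 \<and> (\<chi> i j. complex_of_real (A $ i $ j)) *v v = \<mu> *s v \<longrightarrow> Re \<mu> < 0)"

definition pos_def_matrix :: "real^'n^'n \<Rightarrow> bool" where
  "pos_def_matrix P \<longleftrightarrow> transpose P = P \<and> (\<forall>w. w \<noteq> 0 \<longrightarrow> w \<bullet> (P *v w) > 0)"

definition outer_prod :: "real^'m \<Rightarrow> real^'n \<Rightarrow> real^'n^'m" where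
  "outer_prod u v = (\<chi> r c. u $ r * v $ c)"

text \<open>
  Kronecker products are indexed by pairs: the pair \<open>(i, j)\<close> plays the role of the
  linear index \<open>(i - 1) N + j\<close>.
\<close>

definition kron_vec :: "real^'m \<Rightarrow> real^'n \<Rightarrow> real^('m \<times> 'n)" (infixr "\<otimes>\<^sub>v" 75) where
  "u \<otimes>\<^sub>v v = (\<chi> q. u $ fst q * v $ snd q)"

definition kron_mat :: "real^'a^'b \<Rightarrow> real^'c^'d \<Rightarrow> real^('a \<times> 'c)^('b \<times> 'd)"
    (infixr "\<otimes>\<^sub>m" 75) where
  "A \<otimes>\<^sub>m B = (\<chi> r c. A $ fst r $ fst c * B $ snd r $ snd c)"


section \<open>Autonomous systems\<close>

definition solves_ode ::
  "('a::real_normed_vector \<Rightarrow> 'a) \<Rightarrow> (real \<Rightarrow> 'a) \<Rightarrow> real set \<Rightarrow> bool" where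
  "solves_ode F \<phi> I \<longleftrightarrow> (\<forall>t\<in>I. (\<phi> has_vector_derivative F (\<phi> t)) (at t within I))"

text \<open>For the locally Lipschitz fields used here the trajectory \<open>\<phi>\<close> is determined by \<open>\<phi> 0\<close>.\<close>

definition region_of_attraction :: "('a::real_normed_vector \<Rightarrow> 'a) \<Rightarrow> 'a set" where
  "region_of_attraction F =
     {w. \<exists>\<phi>. solves_ode F \<phi> {0..} \<and> \<phi> 0 = w \<and> (\<phi> \<longlongrightarrow> 0) at_top}"

text \<open>
  Quantifying over compact intervals covers every trajectory on its whole forward interval
  of existence, without presupposing that this interval is unbounded.
\<close>

definition positively_invariant :: "('a::real_normed_vector \<Rightarrow> 'a) \<Rightarrow> 'a set \<Rightarrow> bool" where
  "positively_invariant F S \<longleftrightarrow>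
     (\<forall>\<phi> T. 0 \<le> T \<and> solves_ode F \<phi> {0..T} \<and> \<phi> 0 \<in> S \<longrightarrow> (\<forall>t\<in>{0..T}. \<phi> t \<in> S))"

definition pos_def_quadratic_form :: "(real^'n \<Rightarrow> real) \<Rightarrow> bool" where
  "pos_def_quadratic_form V \<longleftrightarrow> (\<exists>P. pos_def_matrix P \<and> V = (\<lambda>w. w \<bullet> (P *v w)))"

definition global_lyapunov_function :: "(real^'n \<Rightarrow> real^'n) \<Rightarrow> (real^'n \<Rightarrow> real) \<Rightarrow> bool" where
  "global_lyapunov_function F V \<longleftrightarrow>
     pos_def_quadratic_form V \<and> (\<forall>w. w \<noteq> 0 \<longrightarrow> frechet_derivative V (at w) (F w) < 0)"


section \<open>The lift and its stabilized extensions\<close>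

text \<open>
  The lifted space is \<open>real^'N\<close>. Its coordinates are split by \<open>xc\<close> and \<open>yc\<close>: coordinate
  \<open>xc j\<close> carries \<open>x\<^sub>j\<close>, and coordinate \<open>yc i\<close>, for \<open>i < m\<close>, carries the lifted variable
  number \<open>i\<close>, counted from \<open>0\<close>. The number \<open>m\<close> is not the cardinality of a type because it may
  be \<open>0\<close>. Families indexed by \<open>nat\<close> (gains, monomials, factors) are only used below \<open>m\<close>.
\<close>

definition lift_coordinates :: "nat \<Rightarrow> ('n::finite \<Rightarrow> 'N::finite) \<Rightarrow> (nat \<Rightarrow> 'N) \<Rightarrow> bool" where
  "lift_coordinates m xc yc \<longleftrightarrow>
     inj xc \<and> inj_on yc {..<m} \<and> range xc \<inter> yc ` {..<m} = {} \<and> range xc \<union> yc ` {..<m} = UNIV"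

definition monomial :: "('n::finite \<Rightarrow> nat) \<Rightarrow> real^'n \<Rightarrow> real" where
  "monomial \<alpha> x = (\<Prod>j\<in>UNIV. (x $ j) ^ \<alpha> j)"

definition lift_map ::
  "nat \<Rightarrow> ('n::finite \<Rightarrow> 'N::finite) \<Rightarrow> (nat \<Rightarrow> 'N) \<Rightarrow> (nat \<Rightarrow> 'n \<Rightarrow> nat) \<Rightarrow> real^'n \<Rightarrow> real^'N" where
  "lift_map m xc yc \<alpha> x =
     (\<Sum>j\<in>UNIV. axis (xc j) (x $ j)) + (\<Sum>i<m. axis (yc i) (monomial (\<alpha> i) x))"

text \<open>
  The factors of the monomial number \<open>i\<close> are the coordinates \<open>a i\<close> and \<open>b i\<close>: original
  variables or earlier lifted variables.
\<close>

definition inner_quadratic ::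
  "nat \<Rightarrow> ('n::finite \<Rightarrow> 'N::finite) \<Rightarrow> (nat \<Rightarrow> 'N) \<Rightarrow> (nat \<Rightarrow> 'n \<Rightarrow> nat)
     \<Rightarrow> (nat \<Rightarrow> 'N) \<Rightarrow> (nat \<Rightarrow> 'N) \<Rightarrow> bool" where
  "inner_quadratic m xc yc \<alpha> a b \<longleftrightarrow>
     (\<forall>i<m. a i \<in> range xc \<union> yc ` {..<i} \<and> b i \<in> range xc \<union> yc ` {..<i} \<and>
        (\<forall>x. monomial (\<alpha> i) x = lift_map m xc yc \<alpha> x $ a i * lift_map m xc yc \<alpha> x $ b i))"

definition quadratic_field :: "real^'N^'N \<Rightarrow> real^('N \<times> 'N)^'N \<Rightarrow> real^'N \<Rightarrow> real^'N" where
  "quadratic_field A H w = A *v w + H *v (w \<otimes>\<^sub>v w)"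

definition stabilizer ::
  "(nat \<Rightarrow> 'N) \<Rightarrow> (nat \<Rightarrow> 'N) \<Rightarrow> (nat \<Rightarrow> 'N) \<Rightarrow> nat \<Rightarrow> real^'N \<Rightarrow> real" where
  "stabilizer yc a b i w = w $ yc i - w $ a i * w $ b i"

definition stabilized_field ::
  "nat \<Rightarrow> (nat \<Rightarrow> 'N::finite) \<Rightarrow> (nat \<Rightarrow> 'N) \<Rightarrow> (nat \<Rightarrow> 'N) \<Rightarrow> (real^'N \<Rightarrow> real^'N)
     \<Rightarrow> (nat \<Rightarrow> real) \<Rightarrow> real^'N \<Rightarrow> real^'N" where
  "stabilized_field m yc a b F0 \<Lambda> w =
     F0 w - (\<Sum>i<m. (\<Lambda> i * stabilizer yc a b i w) *\<^sub>R axis (yc i) 1)"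

definition stabilized_A ::
  "nat \<Rightarrow> (nat \<Rightarrow> 'N::finite) \<Rightarrow> real^'N^'N \<Rightarrow> (nat \<Rightarrow> real) \<Rightarrow> real^'N^'N" where
  "stabilized_A m yc A0 \<Lambda> =
     A0 - (\<Sum>i<m. \<Lambda> i *\<^sub>R outer_prod (axis (yc i) 1) (axis (yc i) 1))"

definition stabilized_H ::
  "nat \<Rightarrow> (nat \<Rightarrow> 'N::finite) \<Rightarrow> (nat \<Rightarrow> real^('N \<times> 'N)) \<Rightarrow> real^('N \<times> 'N)^'N
     \<Rightarrow> (nat \<Rightarrow> real) \<Rightarrow> real^('N \<times> 'N)^'N" where
  "stabilized_H m yc s H0 \<Lambda> =
     H0 + (\<Sum>i<m. \<Lambda> i *\<^sub>R outer_prod (axis (yc i) 1) (s i))"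


section \<open>The cubic term of the Lyapunov derivative\<close>

definition block :: "real^('N \<times> 'N)^'N \<Rightarrow> 'N \<Rightarrow> real^'N^'N" where
  "block H i = (\<chi> r j. H $ r $ (i, j))"

text \<open>Row \<open>(i, r)\<close> of the vertical stacking is row \<open>r\<close> of its block number \<open>i\<close>.\<close>

definition G_matrix :: "real^'N^'N \<Rightarrow> real^('N \<times> 'N)^'N \<Rightarrow> real^'N^('N \<times> 'N)" where
  "G_matrix P H =
     (\<chi> q. (transpose (block H (fst q)) ** P + P ** block H (fst q)) $ snd q)"

definition J_matrix :: "real^'N^'N \<Rightarrow> real^'N^'N \<Rightarrow> real^('N \<times> 'N)^'N \<Rightarrow> real^'N^('N \<times> 'N)" where
  "J_matrix P Pf H = matrix_inv (transpose Pf \<otimes>\<^sub>m (mat 1 :: real^'N^'N)) ** G_matrix P H"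

end

theory Submission
  imports Defs
begin

text \<open>
  Write \<open>V w = w \<bullet> (P *v w)\<close>. Replacing \<open>H\<close> by \<open>H + K\<close> does not change the field, so along
  \<open>F\<close> the derivative of \<open>V\<close> splits into a quadratic part, which the bound on
  \<open>A\<^sup>T P + P A + I\<close> makes at most \<open>- (1 - \<delta>) (norm w)\<^sup>2\<close>, and a cubic part. The cubic part is
  \<open>(w \<otimes>\<^sub>v w) \<bullet> (G *v w)\<close>; pulling the factor \<open>Pf\<^sup>T \<otimes>\<^sub>m I\<close> out of \<open>G\<close> turns it into
  \<open>((Pf *v w) \<otimes>\<^sub>v w) \<bullet> (J *v w)\<close>, and since \<open>norm (Pf *v w) = sqrt (V w)\<close> it is at most
  \<open>jb * sqrt (V w) * (norm w)\<^sup>2\<close>. Altogether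
  \<open>V' w \<le> - (1 - \<delta> - jb * sqrt (V w)) * (norm w)\<^sup>2\<close>
  (lemma \<open>quadratic_field_lyapunov_derivative_le\<close>). For \<open>jb = 0\<close> this is the global claim. For
  \<open>jb > 0\<close> the bracket is nonnegative up to the level \<open>sqrt (V w) = (1 - \<delta>) / jb\<close> and at least
  \<open>\<eta> (1 - \<delta>)\<close> up to the level \<open>\<rho>\<close>. As \<open>\<rho>\<close> is strictly below the first level, no trajectory can
  leave the ellipsoid, and inside it \<open>V\<close> decays exponentially.

  Membership in the region of attraction also needs a solution on the whole half-line. A field
  that is Lipschitz on balls has one as soon as all its solutions obey one a priori bound: cut the
  field off outside a large ball, solve the bounded globally Lipschitz problem with Banach's fixed
  point theorem, and note that the solution never reaches the cut-off.

  The system in \<open>x\<close> needs no Lyapunov analysis of its own. The stabilizers vanish on the image of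
  the lift, so \<open>\<Phi>\<close> maps solutions of \<open>p\<close> to solutions of \<open>F\<close>. As \<open>norm x \<le> norm (\<Phi> x)\<close>, the
  bound and the decay of the lifted trajectory are inherited by the original one. Both
  attraction claims are instances of one lemma,
  \<open>pullback_sublevel_set_subset_region_of_attraction\<close>, once with the identity and once with \<open>\<Phi>\<close>.
\<close>

section \<open>Existence of solutions on the half-line\<close>

text \<open>
  The Picard operator in a weighted supremum norm. With \<open>y t = x0 + exp (k t) \<psi> t\<close> the integral equation
  becomes a fixed point equation for a bounded continuous \<open>\<psi>\<close>; the weight reduces the Lipschitz
  constant of the integral operator from \<open>L\<close> times the length of the interval to \<open>L / k\<close>, so
  that one application of Banach's theorem covers all positive times.
\<close>

lemma lipschitz_bounded_ode_global_solution:
  fixes f :: "'a::banach \<Rightarrow> 'a"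
  assumes lip: "L-lipschitz_on UNIV f" and bdd: "bounded (range f)"
  shows "\<exists>\<phi>. solves_ode f \<phi> {0..} \<and> \<phi> 0 = x0"
proof -
  \<comment> \<open>Any \<open>k \<ge> 2 L\<close> with \<open>k > 0\<close> makes the operator a contraction with factor \<open>1/2\<close>.\<close>
  define k where "k = 2 * (L + 1)"
  have L0: "0 \<le> L" using lip by (rule lipschitz_on_nonneg)
  hence k0: "k > 0" by (simp add: k_def)
  obtain B where B: "\<And>x. norm (f x) \<le> B" using bdd by (auto simp: bounded_iff)
  have B0: "0 \<le> B" using B[of x0] norm_ge_zero order_trans by blast
  have cf[continuous_intros]: "continuous_on S (\<lambda>s. f (g s))" if "continuous_on S g" for S :: "real set" and g
    using continuous_on_compose2[OF lipschitz_on_continuous_on[OF lip] that] by simp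
  define y where "y \<psi> s = x0 + exp (k * s) *\<^sub>R apply_bcontfun \<psi> s" for \<psi> :: "real \<Rightarrow>\<^sub>C 'a" and s
  define I where "I \<psi> t = integral {0..t} (\<lambda>s. f (y \<psi> s))" for \<psi> t
  \<comment> \<open>Bounded continuous functions live on the whole line; \<open>max 0 t\<close> freezes the value at \<open>0\<close> for
    negative times.\<close>
  define G where "G \<psi> t = exp (- k * max 0 t) *\<^sub>R I \<psi> (max 0 t)" for \<psi> t
  have cy[continuous_intros]: "continuous_on S (y \<psi>)" for \<psi> S
  proof -
    have "continuous_on S (apply_bcontfun \<psi>)" by (rule continuous_on_apply_bcontfun)
    thus ?thesis unfolding y_def[abs_def] by (intro continuous_intros)
  qed
  have int: "(\<lambda>s. f (y \<psi> s)) integrable_on {0..t}" for \<psi> and t :: real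
    by (intro integrable_continuous_real continuous_intros)
  have "continuous_on {0..T} (I \<psi>)" for \<psi> T
    unfolding I_def by (rule indefinite_integral_continuous_1[OF int])
  hence "continuous (at t within {0..}) (I \<psi>)" if "t \<ge> 0" for \<psi> t
    using that at_within_nhd[of t "{..<t+1}" "{0..}" "{0..t+1}"]
    by (fastforce simp: continuous_on_eq_continuous_within)
  hence "continuous_on {0..} (I \<psi>)" for \<psi>
    by (simp add: continuous_on_eq_continuous_within)
  hence "continuous_on UNIV (\<lambda>t. I \<psi> (max 0 t))" for \<psi>
    by (rule continuous_on_compose2) (auto intro!: continuous_intros)
  hence cG: "continuous_on UNIV (G \<psi>)" for \<psi>
    unfolding G_def by (intro continuous_intros)
  have te: "exp (- k * t) * t \<le> 1 / k" for t
  proof -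
    have "k * t \<le> exp (k * t)" using exp_ge_add_one_self[of "k * t"] by linarith
    thus ?thesis using k0 by (simp add: exp_minus field_simps)
  qed
  have "norm (G \<psi> t) \<le> B * (1 / k)" for \<psi> t
  proof -
    have "norm (I \<psi> (max 0 t)) \<le> B * (max 0 t - 0)"
      unfolding I_def by (rule integral_bound) (auto intro!: continuous_intros B)
    hence "norm (G \<psi> t) \<le> exp (- k * max 0 t) * (B * max 0 t)"
      by (simp add: G_def)
    also have "\<dots> = B * (exp (- k * max 0 t) * max 0 t)" by simp
    also have "\<dots> \<le> B * (1 / k)" by (rule mult_left_mono[OF te B0])
    finally show ?thesis .
  qed
  hence bG: "G \<psi> \<in> bcontfun" for \<psi>
    using cG by (auto simp: bcontfun_def bounded_iff)
  define \<G> where "\<G> \<psi> = Bcontfun (G \<psi>)" for \<psi>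
  have \<G>: "apply_bcontfun (\<G> \<psi>) = G \<psi>" for \<psi>
    unfolding \<G>_def by (rule Bcontfun_inverse[OF bG])
  have contraction: "dist (G \<psi> t) (G \<theta> t) \<le> 1 / 2 * dist \<psi> \<theta>" for \<psi> \<theta> t
  proof -
    define r where "r = max 0 t"
    have r0: "0 \<le> r" by (simp add: r_def)
    have pt: "norm (f (y \<psi> s) - f (y \<theta> s)) \<le> L * dist \<psi> \<theta> * exp (k * s)" for s
    proof -
      have "norm (f (y \<psi> s) - f (y \<theta> s)) \<le> L * dist (y \<psi> s) (y \<theta> s)"
        using lipschitz_onD[OF lip] by (simp add: dist_norm)
      also have "dist (y \<psi> s) (y \<theta> s) = exp (k * s) * dist (\<psi> s) (\<theta> s)"
        by (simp add: y_def dist_norm flip: scaleR_diff_right)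
      also have "L * \<dots> \<le> L * (exp (k * s) * dist \<psi> \<theta>)"
        by (intro mult_left_mono L0 dist_bounded) auto
      finally show ?thesis by (simp add: mult_ac)
    qed
    have ie: "((\<lambda>s. exp (k * s)) has_integral (exp (k * r) / k - exp (k * 0) / k)) {0..r}"
      by (rule fundamental_theorem_of_calculus[OF r0])
         (use k0 in \<open>auto intro!: derivative_eq_intros simp flip: has_real_derivative_iff_has_vector_derivative\<close>)
    have "norm (I \<psi> r - I \<theta> r) = norm (integral {0..r} (\<lambda>s. f (y \<psi> s) - f (y \<theta> s)))"
      unfolding I_def by (subst integral_diff) (auto intro: int)
    also have "\<dots> \<le> integral {0..r} (\<lambda>s. L * dist \<psi> \<theta> * exp (k * s))"
      by (rule integral_norm_bound_integral)
         (auto intro!: integrable_continuous_real continuous_intros pt)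
    also have "\<dots> = L * dist \<psi> \<theta> * (exp (k * r) / k - 1 / k)"
      using integral_unique[OF ie] by simp
    also have "\<dots> \<le> L * dist \<psi> \<theta> * (exp (k * r) / k)"
      using L0 k0 by (intro mult_left_mono) auto
    finally have *: "norm (I \<psi> r - I \<theta> r) \<le> L * dist \<psi> \<theta> * (exp (k * r) / k)" .
    have "dist (G \<psi> t) (G \<theta> t) = exp (- k * r) * norm (I \<psi> r - I \<theta> r)"
      by (simp add: G_def dist_norm r_def flip: scaleR_diff_right)
    also have "\<dots> \<le> exp (- k * r) * (L * dist \<psi> \<theta> * (exp (k * r) / k))"
      by (intro mult_left_mono *) auto
    also have "\<dots> = L / k * dist \<psi> \<theta>" by (simp add: exp_minus)
    also have "\<dots> \<le> 1 / 2 * dist \<psi> \<theta>"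
      using L0 by (intro mult_right_mono) (auto simp: k_def field_simps)
    finally show ?thesis .
  qed
  have "\<forall>\<psi> \<theta>. dist (\<G> \<psi>) (\<G> \<theta>) \<le> 1 / 2 * dist \<psi> \<theta>"
    by (intro allI dist_bound) (simp only: \<G> contraction)
  from banach_fix_type[OF _ _ this] obtain \<psi> where fp: "\<G> \<psi> = \<psi>" by auto
  have y_int: "y \<psi> t = x0 + integral {0..t} (\<lambda>s. f (y \<psi> s))" if "t \<ge> 0" for t
  proof -
    have "apply_bcontfun \<psi> t = G \<psi> t" using \<G>[of \<psi>] fp by simp
    thus ?thesis using that by (simp add: y_def[of \<psi> t] G_def I_def exp_minus)
  qed
  have "(y \<psi> has_vector_derivative f (y \<psi> t)) (at t within {0..})" if t: "t \<in> {0..}" for t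
  proof -
    have "((\<lambda>u. x0 + integral {0..u} (\<lambda>s. f (y \<psi> s))) has_vector_derivative (0 + f (y \<psi> t)))
            (at t within {0..t + 1})"
      by (intro has_vector_derivative_add has_vector_derivative_const integral_has_vector_derivative)
         (use t in \<open>auto intro!: continuous_intros\<close>)
    hence "(y \<psi> has_vector_derivative (0 + f (y \<psi> t))) (at t within {0..t + 1})"
      by (rule has_vector_derivative_transform[rotated 2]) (use t y_int in auto)
    moreover have "at t within {0..} = at t within {0..t + 1}"
      by (rule at_within_nhd[of t "{..<t+1}"]) (use t in auto)
    ultimately show ?thesis by simp
  qed
  moreover have "y \<psi> 0 = x0" using y_int[of 0] by simp
  ultimately show ?thesis unfolding solves_ode_def by blast
qed

text \<open>
  The exit-time argument used both for the cut-off and for sublevel sets: up to the first time at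
  which \<open>c\<close> is attained, \<open>u\<close> has not exceeded \<open>c\<close>.
\<close>

lemma first_passage:
  fixes u :: "real \<Rightarrow> real"
  assumes cont: "continuous_on {0..t1} u" and "0 \<le> t1" "u 0 \<le> c" "c \<le> u t1"
  obtains t where "0 \<le> t" "t \<le> t1" "u t = c" "\<And>s. 0 \<le> s \<Longrightarrow> s \<le> t \<Longrightarrow> u s \<le> c"
proof -
  define Z where "Z = {t \<in> {0..t1}. u t = c}"
  have "Z = {0..t1} \<inter> u -` {c}" by (auto simp: Z_def)
  hence "closed Z"
    using continuous_closed_preimage[OF cont closed_atLeastAtMost closed_singleton] by simp
  moreover have "Z \<noteq> {}" using IVT'[of u 0 c t1] assms by (auto simp: Z_def)
  moreover have "bdd_below Z" by (auto simp: Z_def bdd_below_def)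
  ultimately have Inf: "Inf Z \<in> Z" by (simp add: closed_contains_Inf)
  define t where "t = Inf Z"
  have t: "0 \<le> t" "t \<le> t1" "u t = c" using Inf by (auto simp: Z_def t_def)
  have "u s \<le> c" if s: "0 \<le> s" "s \<le> t" for s
  proof (rule ccontr)
    assume "\<not> u s \<le> c"
    then obtain r where r: "0 \<le> r" "r \<le> s" "u r = c"
      using IVT'[of u 0 c s] assms t s continuous_on_subset[OF cont, of "{0..s}"] by auto
    hence "r \<in> Z" using s t by (auto simp: Z_def)
    hence "t \<le> r" unfolding t_def using \<open>bdd_below Z\<close> by (rule cInf_lower)
    hence "r = s" using r s by simp
    thus False using r \<open>\<not> u s \<le> c\<close> by simp
  qed
  thus ?thesis using that t by blast
qed

lemma solves_ode_subset: "solves_ode f \<phi> I \<Longrightarrow> I' \<subseteq> I \<Longrightarrow> solves_ode f \<phi> I'"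
  unfolding solves_ode_def using has_vector_derivative_within_subset by blast

lemma solves_ode_continuous_on: "solves_ode f \<phi> I \<Longrightarrow> continuous_on I \<phi>"
  unfolding solves_ode_def
  by (auto simp: continuous_on_eq_continuous_within intro: has_vector_derivative_continuous)

text \<open>
  Composing \<open>f\<close> with the projection onto the ball of radius \<open>R + 1\<close>, which is 1-Lipschitz, gives a
  bounded globally Lipschitz field that agrees with \<open>f\<close> on that ball. Its solution solves the
  original equation until it first reaches norm \<open>R + 1\<close>, but at that time the bound says that its
  norm is at most \<open>R\<close>.
\<close>

lemma global_solution_if_a_priori_bound:
  fixes f :: "'a::euclidean_space \<Rightarrow> 'a"
  assumes lip: "\<And>r. \<exists>L. L-lipschitz_on (cball 0 r) f"
    and bound: "\<And>\<phi> T. 0 \<le> T \<Longrightarrow> solves_ode f \<phi> {0..T} \<Longrightarrow> \<phi> 0 = x0 \<Longrightarrow> norm (\<phi> T) \<le> R"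
  shows "\<exists>\<phi>. solves_ode f \<phi> {0..} \<and> \<phi> 0 = x0"
proof -
  define C where "C = cball (0::'a) (R + 1)"
  define \<pi> where "\<pi> = closest_point C"
  have x0: "norm x0 \<le> R"
  proof -
    have "solves_ode f (\<lambda>_. x0) {0..0::real}"
      by (simp add: solves_ode_def has_vector_derivative_def has_derivative_within_singleton_iff
          bounded_linear_scaleR_left)
    from bound[OF order_refl this refl] show ?thesis .
  qed
  have "0 \<le> R" using x0 norm_ge_zero order_trans by blast
  hence "(0::'a) \<in> C" by (simp add: C_def)
  hence C: "convex C" "closed C" "C \<noteq> {}" by (auto simp: C_def)
  have \<pi>C: "\<pi> x \<in> C" for x unfolding \<pi>_def using C by (intro closest_point_in_set) auto
  obtain L where L: "L-lipschitz_on C f" using lip C_def by blast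
  have "1-lipschitz_on UNIV \<pi>"
    by (rule lipschitz_onI) (use closest_point_lipschitz[OF C] in \<open>auto simp: \<pi>_def\<close>)
  hence "(L * 1)-lipschitz_on UNIV (f \<circ> \<pi>)"
    by (rule lipschitz_on_compose) (use \<pi>C in \<open>auto intro: lipschitz_on_subset[OF L]\<close>)
  moreover have "bounded (range (f \<circ> \<pi>))"
  proof -
    have "compact (f ` C)"
      by (intro compact_continuous_image lipschitz_on_continuous_on[OF L]) (simp add: C_def)
    thus ?thesis by (rule bounded_subset[OF compact_imp_bounded]) (use \<pi>C in auto)
  qed
  ultimately obtain \<phi> where \<phi>: "solves_ode (f \<circ> \<pi>) \<phi> {0..}" "\<phi> 0 = x0"
    using lipschitz_bounded_ode_global_solution by blast
  have coincide: "solves_ode f \<phi> I" if "I \<subseteq> {0..}" "\<And>t. t \<in> I \<Longrightarrow> norm (\<phi> t) \<le> R + 1" for I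
  proof -
    have "\<pi> (\<phi> t) = \<phi> t" if "t \<in> I" for t
      unfolding \<pi>_def by (rule closest_point_self) (use \<open>\<And>t. t \<in> I \<Longrightarrow> _\<close> that in \<open>simp add: C_def\<close>)
    thus ?thesis using solves_ode_subset[OF \<phi>(1) that(1)] by (simp add: solves_ode_def)
  qed
  have "norm (\<phi> t) \<le> R + 1" if t: "t \<ge> 0" for t
  proof (rule ccontr)
    assume "\<not> norm (\<phi> t) \<le> R + 1"
    moreover have "continuous_on {0..t} (\<lambda>t. norm (\<phi> t))"
      using solves_ode_continuous_on[OF \<phi>(1)]
      by (intro continuous_intros) (auto elim: continuous_on_subset)
    moreover have "norm (\<phi> 0) \<le> R + 1" using x0 \<phi>(2) by simp
    ultimately obtain s where s: "0 \<le> s" "norm (\<phi> s) = R + 1"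
        "\<And>r. 0 \<le> r \<Longrightarrow> r \<le> s \<Longrightarrow> norm (\<phi> r) \<le> R + 1"
      using first_passage[of t "\<lambda>t. norm (\<phi> t)" "R + 1"] t by (metis linear)
    have "norm (\<phi> s) \<le> R"
      by (rule bound[OF s(1) coincide \<phi>(2)]) (use s(3) in auto)
    thus False using s(2) by simp
  qed
  hence "solves_ode f \<phi> {0..}" by (intro coincide) auto
  thus ?thesis using \<phi>(2) by blast
qed

lemma polynomial_function_lipschitz_on_cball:
  fixes p :: "'a::real_normed_vector \<Rightarrow> 'b::euclidean_space"
  assumes "polynomial_function p"
  shows "\<exists>L. L-lipschitz_on (cball 0 r) p"
proof -
  have real: "\<exists>L. L-lipschitz_on (cball 0 r) f" if "real_polynomial_function f" for f :: "'a \<Rightarrow> real"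
    using that
  proof induction
    case (linear f)
    thus ?case using bounded_linear.lipschitz_boundE by metis
  next
    case (const c)
    show ?case using lipschitz_on_constant by blast
  next
    case (add f g)
    thus ?case using lipschitz_on_add by blast
  next
    case (mult f g)
    then obtain L M where L: "L-lipschitz_on (cball 0 r) f" and M: "M-lipschitz_on (cball 0 r) g" by blast
    \<comment> \<open>A product of Lipschitz functions is Lipschitz where both factors are bounded, and a Lipschitz
      function is bounded on a ball.\<close>
    have bd: "\<exists>B\<ge>0. \<forall>x\<in>cball 0 r. \<bar>h x\<bar> \<le> B" if "L-lipschitz_on (cball 0 r) h" for L and h :: "'a \<Rightarrow> real"
    proof (intro exI conjI ballI)
      show "0 \<le> \<bar>h 0\<bar> + L * \<bar>r\<bar>" using lipschitz_on_nonneg[OF that] by simp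
      fix x :: 'a assume x: "x \<in> cball 0 r"
      hence "0 \<in> cball (0::'a) r" using order_trans[OF norm_ge_zero[of x]] by simp
      hence "\<bar>h x - h 0\<bar> \<le> L * norm x"
        using lipschitz_onD[OF that x, of 0] by (simp add: dist_real_def)
      also have "\<dots> \<le> L * \<bar>r\<bar>" using x lipschitz_on_nonneg[OF that] by (intro mult_left_mono) auto
      finally show "\<bar>h x\<bar> \<le> \<bar>h 0\<bar> + L * \<bar>r\<bar>" by linarith
    qed
    obtain B C where B: "0 \<le> B" "\<And>x. x \<in> cball 0 r \<Longrightarrow> \<bar>f x\<bar> \<le> B"
      and C: "0 \<le> C" "\<And>x. x \<in> cball 0 r \<Longrightarrow> \<bar>g x\<bar> \<le> C"
      using bd[OF L] bd[OF M] by blast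
    have "(B * M + C * L)-lipschitz_on (cball 0 r) (\<lambda>x. f x * g x)"
    proof (rule lipschitz_onI)
      show "0 \<le> B * M + C * L" using B C lipschitz_on_nonneg[OF L] lipschitz_on_nonneg[OF M] by simp
      fix x y :: 'a assume xy: "x \<in> cball 0 r" "y \<in> cball 0 r"
      have "f x * g x - f y * g y = f x * (g x - g y) + g y * (f x - f y)" by (simp add: algebra_simps)
      hence "\<bar>f x * g x - f y * g y\<bar> \<le> \<bar>f x\<bar> * \<bar>g x - g y\<bar> + \<bar>g y\<bar> * \<bar>f x - f y\<bar>"
        by (metis abs_mult abs_triangle_ineq)
      also have "\<dots> \<le> B * (M * dist x y) + C * (L * dist x y)"
        using lipschitz_onD[OF L xy] lipschitz_onD[OF M xy] B C xy
        by (intro add_mono mult_mono) (auto simp: dist_real_def)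
      finally show "dist (f x * g x) (f y * g y) \<le> (B * M + C * L) * dist x y"
        by (simp add: dist_real_def algebra_simps)
    qed
    thus ?case by blast
  qed
  have "\<forall>b\<in>Basis. \<exists>L. L-lipschitz_on (cball 0 r) (\<lambda>x. p x \<bullet> b)"
    using assms real by (auto simp: polynomial_function_iff_Basis_inner)
  then obtain L where L: "\<And>b. b \<in> Basis \<Longrightarrow> (L b)-lipschitz_on (cball 0 r) (\<lambda>x. p x \<bullet> b)" by metis
  have "(\<Sum>b\<in>Basis. L b)-lipschitz_on (cball 0 r) p"
  proof (rule lipschitz_onI)
    show "0 \<le> (\<Sum>b\<in>Basis. L b)" using L lipschitz_on_nonneg by (blast intro: sum_nonneg)
    fix x y :: 'a assume xy: "x \<in> cball 0 r" "y \<in> cball 0 r"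
    have "dist (p x) (p y) \<le> (\<Sum>b\<in>Basis. \<bar>(p x - p y) \<bullet> b\<bar>)" unfolding dist_norm by (rule norm_le_l1)
    also have "\<dots> \<le> (\<Sum>b\<in>Basis. L b * dist x y)"
      using lipschitz_onD[OF L xy] by (intro sum_mono) (simp add: dist_real_def inner_diff_left)
    finally show "dist (p x) (p y) \<le> (\<Sum>b\<in>Basis. L b) * dist x y" by (simp add: sum_distrib_right)
  qed
  thus ?thesis by blast
qed

section \<open>Lyapunov functions along solutions\<close>

lemma solves_ode_image:
  assumes \<phi>: "solves_ode f \<phi> I"
    and h: "\<And>x. (h has_derivative h' x) (at x)" "\<And>x. h' x (f x) = g (h x)"
  shows "solves_ode g (h \<circ> \<phi>) I"
  unfolding solves_ode_def
proof
  fix t assume "t \<in> I"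
  hence "(\<phi> has_vector_derivative f (\<phi> t)) (at t within I)" using \<phi> by (simp add: solves_ode_def)
  hence "((h \<circ> \<phi>) has_vector_derivative h' (\<phi> t) (f (\<phi> t))) (at t within I)"
    by (rule vector_derivative_diff_chain_within) (rule has_derivative_at_withinI[OF h(1)])
  thus "((h \<circ> \<phi>) has_vector_derivative g ((h \<circ> \<phi>) t)) (at t within I)" by (simp add: h(2))
qed

text \<open>
  Gronwall's argument: \<open>exp (c t) * V (\<phi> t)\<close> is nonincreasing. The rate \<open>c = 0\<close> is allowed and
  expresses that \<open>V\<close> does not increase.
\<close>

lemma exp_decay_along_solution:
  fixes V :: "'a::real_normed_vector \<Rightarrow> real"
  assumes \<phi>: "solves_ode F \<phi> {0..T}" and T: "0 \<le> T"
    and V: "\<And>w. (V has_derivative DV w) (at w)"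
    and decay: "\<And>t. 0 \<le> t \<Longrightarrow> t \<le> T \<Longrightarrow> DV (\<phi> t) (F (\<phi> t)) \<le> - c * V (\<phi> t)"
  shows "V (\<phi> T) \<le> V (\<phi> 0) * exp (- c * T)"
proof -
  define u where "u t = exp (c * t) * V (\<phi> t)" for t
  have der: "(u has_real_derivative exp (c * t) * (c * V (\<phi> t) + DV (\<phi> t) (F (\<phi> t)))) (at t within {0..T})"
    if "t \<in> {0..T}" for t
  proof -
    have "((V \<circ> \<phi>) has_vector_derivative DV (\<phi> t) (F (\<phi> t))) (at t within {0..T})"
      using \<phi> that by (intro vector_derivative_diff_chain_within has_derivative_at_withinI[OF V])
        (auto simp: solves_ode_def)
    hence "((\<lambda>t. V (\<phi> t)) has_real_derivative DV (\<phi> t) (F (\<phi> t))) (at t within {0..T})"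
      by (simp add: has_real_derivative_iff_has_vector_derivative o_def)
    thus ?thesis unfolding u_def by (auto intro!: derivative_eq_intros simp: algebra_simps)
  qed
  have "u T \<le> u 0"
  proof (rule DERIV_nonpos_imp_decreasing_open[OF T])
    show "continuous_on {0..T} u" using der by (rule DERIV_continuous_on)
    fix t assume t: "0 < t" "t < T"
    have "exp (c * t) * (c * V (\<phi> t) + DV (\<phi> t) (F (\<phi> t))) \<le> 0"
      using decay[of t] t by (intro mult_nonneg_nonpos) auto
    thus "\<exists>d. DERIV u t :> d \<and> d \<le> 0"
      using der[of t] t by (auto simp: at_within_Icc_at)
  qed
  thus ?thesis by (simp add: u_def exp_minus field_simps)
qed

text \<open>
  To leave the set, a trajectory has to reach some level \<open>c\<close> with \<open>r < c \<le> r'\<close>. Up to the first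
  passage it stays where \<open>V\<close> does not increase. The margin between \<open>r\<close> and \<open>r'\<close> makes it enough that
  the derivative is nonpositive.
\<close>

lemma sublevel_set_positively_invariant:
  fixes V :: "'a::real_normed_vector \<Rightarrow> real"
  assumes V: "\<And>w. (V has_derivative DV w) (at w)"
    and decrease: "\<And>w. V w \<le> r' \<Longrightarrow> DV w (F w) \<le> 0"
    and r: "r < r'"
  shows "positively_invariant F {w. V w \<le> r}"
  unfolding positively_invariant_def
proof (intro allI impI ballI, elim conjE)
  fix \<phi> T t
  assume \<phi>: "solves_ode F \<phi> {0..T}" and init: "\<phi> 0 \<in> {w. V w \<le> r}" and t: "t \<in> {0..T}"
  show "\<phi> t \<in> {w. V w \<le> r}"
  proof (rule ccontr)
    assume "\<phi> t \<notin> {w. V w \<le> r}"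
    define c where "c = min (V (\<phi> t)) r'"
    have c: "r < c" "c \<le> r'" "c \<le> V (\<phi> t)" using \<open>\<phi> t \<notin> _\<close> r by (auto simp: c_def)
    have "continuous_on UNIV V"
      using has_derivative_continuous[OF V] by (auto simp: continuous_on_eq_continuous_at)
    moreover have "continuous_on {0..t} \<phi>"
      using t by (auto intro: continuous_on_subset[OF solves_ode_continuous_on[OF \<phi>]])
    ultimately have "continuous_on {0..t} (\<lambda>t. V (\<phi> t))"
      by (auto intro: continuous_on_compose2)
    then obtain s where s: "0 \<le> s" "s \<le> t" "V (\<phi> s) = c" "\<And>q. 0 \<le> q \<Longrightarrow> q \<le> s \<Longrightarrow> V (\<phi> q) \<le> c"
    proof (rule first_passage)
      show "0 \<le> t" "V (\<phi> 0) \<le> c" "c \<le> V (\<phi> t)" using t init c by auto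
    qed blast
    have "V (\<phi> s) \<le> V (\<phi> 0) * exp (- 0 * s)"
    proof (rule exp_decay_along_solution[where T=s, OF _ s(1) V])
      show "solves_ode F \<phi> {0..s}" using s t by (auto intro: solves_ode_subset[OF \<phi>])
    qed (use s(4) c in \<open>auto intro!: decrease intro: order_trans\<close>)
    thus False using s(3) init c by simp
  qed
qed

text \<open>
  The map \<open>h\<close> sends solutions of \<open>f\<close> to solutions of \<open>F\<close> and does not decrease norms, so invariance
  and decay for \<open>F\<close> bound the solutions of \<open>f\<close>: first a priori, which yields existence for all
  times, and then by an exponentially small quantity.
\<close>

lemma pullback_sublevel_set_subset_region_of_attraction:
  fixes V :: "'b::real_normed_vector \<Rightarrow> real" and f :: "'a::euclidean_space \<Rightarrow> 'a"
  assumes V: "\<And>w. (V has_derivative DV w) (at w)"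
    and coercive: "\<And>w. (norm w)\<^sup>2 \<le> \<beta> * V w" "0 < \<beta>"
    and decay: "\<And>w. V w \<le> r \<Longrightarrow> DV w (F w) \<le> - c * V w" "0 < c"
    and invariant: "positively_invariant F {w. V w \<le> r}"
    and lip: "\<And>R. \<exists>L. L-lipschitz_on (cball 0 R) f"
    and h: "\<And>x. (h has_derivative h' x) (at x)" "\<And>x. h' x (f x) = F (h x)"
    and norm_h: "\<And>x. norm x \<le> norm (h x)"
  shows "{x. V (h x) \<le> r} \<subseteq> region_of_attraction f"
proof
  fix x assume x: "x \<in> {x. V (h x) \<le> r}"
  have stays: "V (h (\<phi> t)) \<le> r"
    if "solves_ode f \<phi> {0..T}" "\<phi> 0 = x" "0 \<le> t" "t \<le> T" for \<phi> t T
  proof -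
    have "solves_ode F (h \<circ> \<phi>) {0..T}" by (rule solves_ode_image[OF that(1) h])
    moreover have "(h \<circ> \<phi>) 0 \<in> {w. V w \<le> r}" using x that(2) by simp
    ultimately have "(h \<circ> \<phi>) t \<in> {w. V w \<le> r}"
      using invariant that(3,4) unfolding positively_invariant_def
      by (meson atLeastAtMost_iff order_trans)
    thus ?thesis by simp
  qed
  have norm_le: "norm y \<le> sqrt (\<beta> * V (h y))" for y
    by (rule order_trans[OF norm_h]) (use coercive(1)[of "h y"] in \<open>simp add: real_le_rsqrt\<close>)
  obtain \<phi> where \<phi>: "solves_ode f \<phi> {0..}" "\<phi> 0 = x"
  proof -
    have "\<exists>\<phi>. solves_ode f \<phi> {0..} \<and> \<phi> 0 = x"
    proof (rule global_solution_if_a_priori_bound[OF lip])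
      fix \<phi> T assume "0 \<le> (T::real)" "solves_ode f \<phi> {0..T}" "\<phi> 0 = x"
      hence "V (h (\<phi> T)) \<le> r" using stays by blast
      thus "norm (\<phi> T) \<le> sqrt (\<beta> * r)"
        using coercive(2) by (intro order_trans[OF norm_le]) simp
    qed
    thus ?thesis using that by blast
  qed
  have bound: "norm (\<phi> t) \<le> sqrt (\<beta> * (V (h x) * exp (- c * t)))" if t: "0 \<le> t" for t
  proof -
    have sub: "solves_ode f \<phi> {0..t}" by (rule solves_ode_subset[OF \<phi>(1)]) auto
    have "V ((h \<circ> \<phi>) t) \<le> V ((h \<circ> \<phi>) 0) * exp (- c * t)"
    proof (rule exp_decay_along_solution[OF _ t V])
      show "solves_ode F (h \<circ> \<phi>) {0..t}" by (rule solves_ode_image[OF sub h])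
      show "DV ((h \<circ> \<phi>) s) (F ((h \<circ> \<phi>) s)) \<le> - c * V ((h \<circ> \<phi>) s)" if "0 \<le> s" "s \<le> t" for s
        using stays[OF sub \<phi>(2) that] by (intro decay(1)) simp
    qed
    thus ?thesis using \<phi>(2) coercive(2) by (intro order_trans[OF norm_le]) simp
  qed
  have "filterlim (\<lambda>t. c * t) at_top at_top"
    by (rule filterlim_tendsto_pos_mult_at_top[OF tendsto_const decay(2) filterlim_ident])
  hence "((\<lambda>t. exp (- c * t)) \<longlongrightarrow> 0) at_top"
    by (intro filterlim_compose[OF exp_at_bot]) (simp add: filterlim_uminus_at_bot)
  hence "((\<lambda>t. sqrt (\<beta> * (V (h x) * exp (- c * t)))) \<longlongrightarrow> sqrt (\<beta> * (V (h x) * 0))) at_top"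
    by (intro tendsto_intros)
  hence "((\<lambda>t. sqrt (\<beta> * (V (h x) * exp (- c * t)))) \<longlongrightarrow> 0) at_top" by simp
  hence "(\<phi> \<longlongrightarrow> 0) at_top"
    by (rule Lim_null_comparison[rotated])
       (use bound in \<open>auto intro!: eventually_mono[OF eventually_ge_at_top[of 0]]\<close>)
  thus "x \<in> region_of_attraction f" using \<phi> by (auto simp: region_of_attraction_def)
qed

section \<open>Kronecker products and the spectral norm\<close>

lemma kron_mat_mult: "(A \<otimes>\<^sub>m B) ** (C \<otimes>\<^sub>m D) = (A ** C) \<otimes>\<^sub>m (B ** D)"
proof -
  have "((A \<otimes>\<^sub>m B) ** (C \<otimes>\<^sub>m D)) $ r $ c = ((A ** C) \<otimes>\<^sub>m (B ** D)) $ r $ c" for r c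
  proof -
    have "((A \<otimes>\<^sub>m B) ** (C \<otimes>\<^sub>m D)) $ r $ c
        = (\<Sum>q\<in>UNIV. (A $ fst r $ fst q * C $ fst q $ fst c) * (B $ snd r $ snd q * D $ snd q $ snd c))"
      by (simp add: matrix_matrix_mult_def kron_mat_def mult_ac)
    also have "\<dots> = (\<Sum>i\<in>UNIV. \<Sum>j\<in>UNIV. (A $ fst r $ i * C $ i $ fst c) * (B $ snd r $ j * D $ j $ snd c))"
      by (simp add: sum.cartesian_product flip: UNIV_Times_UNIV) (simp add: case_prod_beta)
    also have "\<dots> = ((A ** C) \<otimes>\<^sub>m (B ** D)) $ r $ c"
      by (simp add: matrix_matrix_mult_def kron_mat_def sum_product)
    finally show ?thesis .
  qed
  thus ?thesis by (simp add: vec_eq_iff)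
qed

lemma kron_mat_one: "mat 1 \<otimes>\<^sub>m mat 1 = (mat 1 :: real^('a::finite \<times> 'b::finite)^('a \<times> 'b))"
  by (auto simp: vec_eq_iff kron_mat_def mat_def prod_eq_iff)

lemma kron_mat_vec: "(A \<otimes>\<^sub>m B) *v (u \<otimes>\<^sub>v v) = (A *v u) \<otimes>\<^sub>v (B *v v)"
proof -
  have "((A \<otimes>\<^sub>m B) *v (u \<otimes>\<^sub>v v)) $ r = ((A *v u) \<otimes>\<^sub>v (B *v v)) $ r" for r
  proof -
    have "((A \<otimes>\<^sub>m B) *v (u \<otimes>\<^sub>v v)) $ r
        = (\<Sum>q\<in>UNIV. (A $ fst r $ fst q * u $ fst q) * (B $ snd r $ snd q * v $ snd q))"
      by (simp add: matrix_vector_mult_def kron_mat_def kron_vec_def mult_ac)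
    also have "\<dots> = (\<Sum>i\<in>UNIV. \<Sum>j\<in>UNIV. (A $ fst r $ i * u $ i) * (B $ snd r $ j * v $ j))"
      by (simp add: sum.cartesian_product flip: UNIV_Times_UNIV) (simp add: case_prod_beta)
    also have "\<dots> = ((A *v u) \<otimes>\<^sub>v (B *v v)) $ r"
      by (simp add: matrix_vector_mult_def kron_vec_def sum_product)
    finally show ?thesis .
  qed
  thus ?thesis by (simp add: vec_eq_iff)
qed

lemma transpose_kron_mat: "transpose (A \<otimes>\<^sub>m B) = transpose A \<otimes>\<^sub>m transpose B"
  by (simp add: vec_eq_iff kron_mat_def transpose_def)

lemma norm_kron_vec: "norm (u \<otimes>\<^sub>v v) = norm u * norm v"
proof -
  have "(norm (u \<otimes>\<^sub>v v))\<^sup>2 = (\<Sum>i\<in>UNIV. \<Sum>j\<in>UNIV. (u $ i * u $ i) * (v $ j * v $ j))"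
    by (simp add: power2_norm_eq_inner inner_vec_def kron_vec_def sum.cartesian_product mult_ac
        flip: UNIV_Times_UNIV) (simp add: case_prod_beta)
  also have "\<dots> = (norm u * norm v)\<^sup>2"
    by (simp add: power_mult_distrib power2_norm_eq_inner inner_vec_def sum_product)
  finally show ?thesis by (simp add: power2_eq_iff_nonneg)
qed

lemma matrix_inv_right:
  assumes "invertible (A :: 'a::semiring_1^'n^'n)"
  shows "A ** matrix_inv A = mat 1"
  using someI_ex[OF assms[unfolded invertible_def]] by (simp add: matrix_inv_def)

lemma invertible_kron_mat_id:
  fixes A :: "real^'n^'n"
  assumes "invertible A"
  shows "invertible (A \<otimes>\<^sub>m (mat 1 :: real^'k^'k))"
  unfolding invertible_right_inverse
proof
  show "(A \<otimes>\<^sub>m mat 1) ** (matrix_inv A \<otimes>\<^sub>m mat 1) = (mat 1 :: real^('n \<times> 'k)^('n \<times> 'k))"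
    by (simp add: kron_mat_mult matrix_inv_right[OF assms] kron_mat_one)
qed

lemma inner_matrix_le_spectral_norm: "u \<bullet> (M *v v) \<le> spectral_norm M * norm u * norm v"
proof -
  have "u \<bullet> (M *v v) \<le> norm u * norm (M *v v)" by (rule norm_cauchy_schwarz)
  also have "\<dots> \<le> norm u * (onorm ((*v) M) * norm v)"
    by (intro mult_left_mono onorm) auto
  finally show ?thesis by (simp add: spectral_norm_def mult_ac)
qed

lemma inner_transpose: "u \<bullet> (transpose M *v v) = (M *v u) \<bullet> (v :: real^'n)"
  by (metis dot_lmul_matrix inner_commute transpose_matrix_vector)

section \<open>The Lyapunov derivative of a quadratic field\<close>

lemma quadratic_form_has_derivative:
  fixes P :: "real^'N^'N"
  assumes tP: "transpose P = P"
  shows "((\<lambda>w. w \<bullet> (P *v w)) has_derivative (\<lambda>h. 2 * ((P *v w) \<bullet> h))) (at w)"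
proof -
  have "((\<lambda>w. P *v w) has_derivative (\<lambda>h. P *v h)) (at w)"
    by (rule bounded_linear_imp_has_derivative) simp
  hence "((\<lambda>w. w \<bullet> (P *v w)) has_derivative (\<lambda>h. w \<bullet> (P *v h) + h \<bullet> (P *v w))) (at w)"
    by (intro derivative_intros)
  moreover have "w \<bullet> (P *v h) = (P *v w) \<bullet> h" for h using inner_transpose[of w P h] tP by simp
  ultimately show ?thesis by (simp add: inner_commute[of _ "P *v w"])
qed

lemma quadratic_term_blocks:
  fixes H :: "real^('N \<times> 'N)^'N"
  shows "H *v (w \<otimes>\<^sub>v w) = (\<Sum>i\<in>UNIV. w $ i *\<^sub>R (block H i *v w))"
proof -
  have "(H *v (w \<otimes>\<^sub>v w)) $ r = (\<Sum>i\<in>UNIV. w $ i *\<^sub>R (block H i *v w)) $ r" for r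
    by (simp add: matrix_vector_mult_def kron_vec_def block_def sum_distrib_left sum.cartesian_product mult_ac
        flip: UNIV_Times_UNIV) (simp add: case_prod_beta)
  thus ?thesis by (simp add: vec_eq_iff)
qed

text \<open>
  The quadratic term is \<open>\<Sum>i. w\<^sub>i M\<^sub>i w\<close> for the blocks \<open>M\<^sub>i\<close>, and each scalar
  \<open>2 (P w) \<bullet> (M\<^sub>i w)\<close> is symmetrized to \<open>w \<bullet> ((M\<^sub>i\<^sup>T P + P M\<^sub>i) w)\<close>. Collecting the products
  \<open>w\<^sub>i w\<^sub>r\<close> gives the stacked matrix.
\<close>

lemma cubic_term_eq:
  fixes P :: "real^'N^'N" and H :: "real^('N \<times> 'N)^'N"
  assumes tP: "transpose P = P"
  shows "2 * ((P *v w) \<bullet> (H *v (w \<otimes>\<^sub>v w))) = (w \<otimes>\<^sub>v w) \<bullet> (G_matrix P H *v w)"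
proof -
  define M where "M i = transpose (block H i) ** P + P ** block H i" for i
  have Mi: "w \<bullet> (M i *v w) = 2 * ((P *v w) \<bullet> (block H i *v w))" for i
  proof -
    have "w \<bullet> (P *v (block H i *v w)) = (P *v w) \<bullet> (block H i *v w)"
      using inner_transpose[of w P] tP by simp
    moreover have "w \<bullet> (transpose (block H i) *v (P *v w)) = (P *v w) \<bullet> (block H i *v w)"
      by (simp only: inner_transpose inner_commute)
    ultimately show ?thesis
      by (simp add: M_def matrix_vector_mult_add_rdistrib inner_right_distrib
          del: transpose_matrix_vector flip: matrix_vector_mul_assoc)
  qed
  have "(w \<otimes>\<^sub>v w) \<bullet> (G_matrix P H *v w) = (\<Sum>i\<in>UNIV. w $ i * (w \<bullet> (M i *v w)))"
  proof -
    have "(G_matrix P H *v w) $ q = (M (fst q) *v w) $ snd q" for q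
      by (simp add: G_matrix_def M_def matrix_vector_mult_def)
    hence "(w \<otimes>\<^sub>v w) \<bullet> (G_matrix P H *v w) = (\<Sum>q\<in>UNIV. w $ fst q * (w $ snd q * (M (fst q) *v w) $ snd q))"
      by (simp add: inner_vec_def kron_vec_def mult_ac)
    also have "\<dots> = (\<Sum>i\<in>UNIV. \<Sum>r\<in>UNIV. w $ i * (w $ r * (M i *v w) $ r))"
      by (simp add: sum.cartesian_product flip: UNIV_Times_UNIV) (simp add: case_prod_beta)
    finally show ?thesis by (simp add: inner_vec_def sum_distrib_left)
  qed
  also have "\<dots> = 2 * ((P *v w) \<bullet> (H *v (w \<otimes>\<^sub>v w)))"
    by (simp add: Mi quadratic_term_blocks inner_sum_right sum_distrib_left mult_ac)
  finally show ?thesis by simp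
qed

context
  fixes P Pf :: "real^'N::finite^'N"
  assumes P: "pos_def_matrix P" and Pf: "P = transpose Pf ** Pf"
begin

lemma pos_def_eq_norm_factor: "w \<bullet> (P *v w) = (norm (Pf *v w))\<^sup>2"
  by (simp only: Pf matrix_vector_mul_assoc[symmetric] inner_transpose power2_norm_eq_inner)

lemma invertible_factor: "invertible Pf"
proof -
  have "w = 0" if "Pf *v w = 0" for w
    using P pos_def_eq_norm_factor[of w] that by (force simp: pos_def_matrix_def)
  thus ?thesis by (simp add: invertible_left_inverse matrix_left_invertible_ker)
qed

lemma norm_le_pos_def: "\<exists>\<beta>>0. \<forall>w. (norm w)\<^sup>2 \<le> \<beta> * (w \<bullet> (P *v w))"
proof -
  \<comment> \<open>The constant is the square of an operator norm bound \<open>b\<close> for the inverse of \<open>Pf\<close>: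
    \<open>norm w = norm (B *v (Pf *v w)) \<le> b * norm (Pf *v w)\<close>.\<close>
  obtain B where B: "B ** Pf = mat 1" using invertible_factor invertible_left_inverse by blast
  obtain b where b: "b > 0" "\<And>w. norm (B *v w) \<le> norm w * b"
    using bounded_linear.pos_bounded[OF matrix_vector_mul_bounded_linear[of B]] by blast
  have "(norm w)\<^sup>2 \<le> b\<^sup>2 * (w \<bullet> (P *v w))" for w
    using power_mono[OF b(2)[of "Pf *v w"], of 2]
    by (simp add: matrix_vector_mul_assoc B pos_def_eq_norm_factor power_mult_distrib mult_ac)
  thus ?thesis using b(1) by (intro exI[of _ "b\<^sup>2"]) auto
qed

lemma pos_def_le_norm: "\<exists>\<beta>>0. \<forall>w. w \<bullet> (P *v w) \<le> \<beta> * (norm w)\<^sup>2"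
proof -
  obtain b where b: "b > 0" "\<And>w. norm (Pf *v w) \<le> norm w * b"
    using bounded_linear.pos_bounded[OF matrix_vector_mul_bounded_linear[of Pf]] by blast
  have "w \<bullet> (P *v w) \<le> b\<^sup>2 * (norm w)\<^sup>2" for w
    using power_mono[OF b(2)[of w], of 2]
    by (simp add: pos_def_eq_norm_factor power_mult_distrib mult_ac)
  thus ?thesis using b(1) by (intro exI[of _ "b\<^sup>2"]) auto
qed

text \<open>
  The matrix \<open>J\<close> is \<open>G\<close> with the factor \<open>Pf\<^sup>T \<otimes>\<^sub>m I\<close> removed. Moving that factor to the
  other side of the inner product replaces \<open>w \<otimes>\<^sub>v w\<close> by \<open>(Pf *v w) \<otimes>\<^sub>v w\<close>, whose norm is
  \<open>sqrt (w \<bullet> (P *v w)) * norm w\<close>: one power of the Euclidean norm has become the norm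
  that defines the ellipsoid.
\<close>

lemma cubic_term_le:
  fixes H :: "real^('N \<times> 'N)^'N"
  shows "2 * ((P *v w) \<bullet> (H *v (w \<otimes>\<^sub>v w)))
      \<le> spectral_norm (J_matrix P Pf H) * sqrt (w \<bullet> (P *v w)) * (norm w)\<^sup>2"
proof -
  have tP: "transpose P = P" using P by (simp add: pos_def_matrix_def)
  define Q where "Q = transpose Pf \<otimes>\<^sub>m (mat 1 :: real^'N^'N)"
  have "invertible (transpose Pf)" by (rule transpose_invertible[OF invertible_factor])
  hence "Q ** matrix_inv Q = mat 1"
    unfolding Q_def by (intro matrix_inv_right invertible_kron_mat_id)
  hence G: "G_matrix P H = Q ** J_matrix P Pf H"
    by (simp add: J_matrix_def matrix_mul_assoc flip: Q_def)
  have "2 * ((P *v w) \<bullet> (H *v (w \<otimes>\<^sub>v w))) = (w \<otimes>\<^sub>v w) \<bullet> (Q *v (J_matrix P Pf H *v w))"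
    by (simp add: cubic_term_eq[OF tP] G matrix_vector_mul_assoc)
  also have "\<dots> = (transpose Q *v (w \<otimes>\<^sub>v w)) \<bullet> (J_matrix P Pf H *v w)"
    using inner_transpose[of _ "transpose Q"] by (simp only: transpose_transpose)
  also have "transpose Q *v (w \<otimes>\<^sub>v w) = (Pf *v w) \<otimes>\<^sub>v w"
    by (simp add: Q_def transpose_kron_mat kron_mat_vec transpose_mat del: transpose_matrix_vector)
  also have "\<dots> \<bullet> (J_matrix P Pf H *v w)
      \<le> spectral_norm (J_matrix P Pf H) * norm ((Pf *v w) \<otimes>\<^sub>v w) * norm w"
    by (rule inner_matrix_le_spectral_norm)
  also have "\<dots> = spectral_norm (J_matrix P Pf H) * sqrt (w \<bullet> (P *v w)) * (norm w)\<^sup>2"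
    by (simp add: norm_kron_vec pos_def_eq_norm_factor power2_eq_square)
  finally show ?thesis .
qed

text \<open>
  The combination of both estimates: \<open>2 (P w) \<bullet> (A w)\<close> equals \<open>w \<bullet> (E w) - (norm w)\<^sup>2\<close> with
  \<open>E = A\<^sup>T P + P A + I\<close>, and the cubic term is bounded by \<open>cubic_term_le\<close>.
\<close>

lemma quadratic_field_lyapunov_derivative_le:
  fixes A :: "real^'N^'N" and H :: "real^('N \<times> 'N)^'N"
  assumes A: "spectral_norm (transpose A ** P + P ** A + mat 1) \<le> \<delta>"
    and J: "spectral_norm (J_matrix P Pf H) \<le> j"
  shows "2 * ((P *v w) \<bullet> quadratic_field A H w)
      \<le> - ((1 - \<delta> - j * sqrt (w \<bullet> (P *v w))) * (norm w)\<^sup>2)"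
proof -
  define E where "E = transpose A ** P + P ** A + mat 1"
  have tP: "transpose P = P" using P by (simp add: pos_def_matrix_def)
  have "w \<bullet> (P *v (A *v w)) = (P *v w) \<bullet> (A *v w)" using inner_transpose[of w P] tP by simp
  moreover have "w \<bullet> (transpose A *v (P *v w)) = (P *v w) \<bullet> (A *v w)"
    by (simp only: inner_transpose inner_commute)
  ultimately have "2 * ((P *v w) \<bullet> (A *v w)) = w \<bullet> (E *v w) - (norm w)\<^sup>2"
    by (simp add: E_def matrix_vector_mult_add_rdistrib inner_right_distrib power2_norm_eq_inner
        del: transpose_matrix_vector flip: matrix_vector_mul_assoc)
  moreover have "w \<bullet> (E *v w) \<le> \<delta> * (norm w)\<^sup>2"
  proof -
    have "w \<bullet> (E *v w) \<le> spectral_norm E * norm w * norm w" by (rule inner_matrix_le_spectral_norm)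
    also have "\<dots> = spectral_norm E * (norm w)\<^sup>2" by (simp add: power2_eq_square)
    also have "\<dots> \<le> \<delta> * (norm w)\<^sup>2" using A by (intro mult_right_mono) (auto simp: E_def)
    finally show ?thesis .
  qed
  moreover have "2 * ((P *v w) \<bullet> (H *v (w \<otimes>\<^sub>v w))) \<le> j * sqrt (w \<bullet> (P *v w)) * (norm w)\<^sup>2"
  proof (rule order_trans[OF cubic_term_le])
    show "spectral_norm (J_matrix P Pf H) * sqrt (w \<bullet> (P *v w)) * (norm w)\<^sup>2
        \<le> j * sqrt (w \<bullet> (P *v w)) * (norm w)\<^sup>2"
      using J by (intro mult_right_mono) (auto simp: pos_def_eq_norm_factor)
  qed
  ultimately show ?thesis by (simp add: quadratic_field_def inner_right_distrib algebra_simps)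
qed

end

section \<open>The lift and the stabilized field\<close>

lemma polynomial_function_vec:
  fixes f :: "'a::real_normed_vector \<Rightarrow> real^'n"
  shows "polynomial_function f \<longleftrightarrow> (\<forall>i. real_polynomial_function (\<lambda>x. f x $ i))"
  unfolding polynomial_function_iff_Basis_inner Basis_vec_def
  by (auto simp: inner_axis real_polynomial_function_eq)

lemma real_polynomial_function_nth: "real_polynomial_function (\<lambda>w :: real^'n. w $ i)"
  by (rule real_polynomial_function.intros(1)) (rule bounded_linear_vec_nth)

lemma polynomial_function_quadratic_field: "polynomial_function (quadratic_field A H)"
  unfolding polynomial_function_vec quadratic_field_def
  by (auto simp: matrix_vector_mult_def kron_vec_def
      intro!: real_polynomial_function.intros(2-) real_polynomial_function_sum real_polynomial_function_nth)

lemma polynomial_function_lift_map: "polynomial_function (lift_map m xc yc \<alpha>)"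
proof -
  have axis: "real_polynomial_function (\<lambda>x. axis k (f x) $ i)" if "real_polynomial_function f"
    for k i and f :: "real^'n \<Rightarrow> real"
    using that by (cases "i = k") (auto simp: axis_def)
  show ?thesis
    unfolding polynomial_function_vec lift_map_def monomial_def
    by (auto intro!: real_polynomial_function.intros(2-) real_polynomial_function_sum axis
        real_polynomial_function_prod real_polynomial_function_power real_polynomial_function_nth)
qed

lemma lift_map_has_derivative:
  "(lift_map m xc yc \<alpha> has_derivative (\<lambda>h. jacobian (lift_map m xc yc \<alpha>) (at x) *v h)) (at x)"
  using differentiable_at_polynomial_function[OF polynomial_function_lift_map]
  by (simp flip: jacobian_works)

lemma stabilized_field_eq_quadratic_field:
  assumes s: "\<And>i w. i < m \<Longrightarrow> s i \<bullet> (w \<otimes>\<^sub>v w) = w $ a i * w $ b i"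
  shows "stabilized_field m yc a b (quadratic_field A0 H0) \<Lambda>
     = quadratic_field (stabilized_A m yc A0 \<Lambda>) (stabilized_H m yc s H0 \<Lambda>)"
proof
  fix w
  have outer: "outer_prod u v *v x = (v \<bullet> x) *\<^sub>R u" for u v x
    by (simp add: vec_eq_iff outer_prod_def matrix_vector_mult_def inner_vec_def sum_distrib_left mult_ac)
  have sum: "(\<Sum>i<m. f i) *v x = (\<Sum>i<m. f i *v x)" for f x
    by (induction m) (auto simp: matrix_vector_mult_add_rdistrib)
  show "stabilized_field m yc a b (quadratic_field A0 H0) \<Lambda> w
     = quadratic_field (stabilized_A m yc A0 \<Lambda>) (stabilized_H m yc s H0 \<Lambda>) w"
    by (simp add: stabilized_field_def quadratic_field_def stabilized_A_def stabilized_H_def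
        matrix_vector_mult_add_rdistrib matrix_vector_mult_diff_rdistrib sum scaleR_matrix_vector_assoc[symmetric]
        outer s stabilizer_def inner_axis' sum_subtractf algebra_simps)
qed

context
  fixes m :: nat and xc :: "'n::finite \<Rightarrow> 'N::finite" and yc :: "nat \<Rightarrow> 'N" and \<alpha> :: "nat \<Rightarrow> 'n \<Rightarrow> nat"
  assumes coords: "lift_coordinates m xc yc"
begin

lemma lift_map_xc: "lift_map m xc yc \<alpha> x $ xc j = x $ j"
proof -
  have "(\<Sum>k\<in>UNIV. axis (xc k) (x $ k)) $ xc j = (\<Sum>k\<in>UNIV. if k = j then x $ k else 0)"
    unfolding sum_component using coords by (intro sum.cong) (auto simp: axis_def lift_coordinates_def inj_eq)
  moreover have "(\<Sum>i<m. axis (yc i) (monomial (\<alpha> i) x)) $ xc j = 0"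
    unfolding sum_component using coords by (intro sum.neutral) (auto simp: axis_def lift_coordinates_def)
  ultimately show ?thesis by (simp add: lift_map_def)
qed

lemma lift_map_yc:
  assumes "i < m"
  shows "lift_map m xc yc \<alpha> x $ yc i = monomial (\<alpha> i) x"
proof -
  have "(\<Sum>k\<in>UNIV. axis (xc k) (x $ k)) $ yc i = 0"
    unfolding sum_component using coords assms by (intro sum.neutral) (auto simp: axis_def lift_coordinates_def)
  moreover have "(\<Sum>k<m. axis (yc k) (monomial (\<alpha> k) x)) $ yc i
      = (\<Sum>k<m. if k = i then monomial (\<alpha> k) x else 0)"
    unfolding sum_component using coords assms
    by (intro sum.cong) (auto simp: axis_def lift_coordinates_def inj_on_def)
  ultimately show ?thesis using assms by (simp add: lift_map_def)
qed

lemma norm_le_norm_lift_map: "norm x \<le> norm (lift_map m xc yc \<alpha> x)"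
proof -
  have sq: "(norm v)\<^sup>2 = (\<Sum>i\<in>UNIV. (v $ i)\<^sup>2)" for v :: "real^'k"
    by (simp add: norm_vec_def L2_set_def sum_nonneg)
  let ?w = "lift_map m xc yc \<alpha> x"
  have inj: "inj xc" using coords by (simp add: lift_coordinates_def)
  have "(norm x)\<^sup>2 = (\<Sum>j\<in>UNIV. (?w $ xc j)\<^sup>2)"
    by (simp add: sq lift_map_xc)
  also have "\<dots> = (\<Sum>i\<in>range xc. (?w $ i)\<^sup>2)" using inj by (simp add: sum.reindex)
  also have "\<dots> \<le> (\<Sum>i\<in>UNIV. (?w $ i)\<^sup>2)" by (intro sum_mono2) auto
  also have "\<dots> = (norm ?w)\<^sup>2" by (simp add: sq)
  finally show ?thesis by (rule power2_le_imp_le) simp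
qed

text \<open>
  Every stabilizer vanishes on the image of the lift, because there the lifted variable is the
  product of its two factors. Hence the gains are invisible to the original system.
\<close>

lemma stabilized_field_lift_map:
  assumes "inner_quadratic m xc yc \<alpha> a b"
  shows "stabilized_field m yc a b F0 \<Lambda> (lift_map m xc yc \<alpha> x) = F0 (lift_map m xc yc \<alpha> x)"
proof -
  have "stabilizer yc a b i (lift_map m xc yc \<alpha> x) = 0" if "i < m" for i
    using assms that by (simp add: stabilizer_def lift_map_yc inner_quadratic_def)
  thus ?thesis by (simp add: stabilized_field_def)
qed

end

section \<open>The certified ellipsoid\<close>

theorem corollary3p12:
  fixes p :: "real^'n \<Rightarrow> real^'n"
    and m :: nat
    and xc :: "'n \<Rightarrow> 'N::finite"
    and yc :: "nat \<Rightarrow> 'N"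
    and \<alpha> :: "nat \<Rightarrow> 'n \<Rightarrow> nat"
    and a b :: "nat \<Rightarrow> 'N"
    and A0 :: "real^'N^'N"
    and H0 :: "real^('N \<times> 'N)^'N"
    and s :: "nat \<Rightarrow> real^('N \<times> 'N)"
    and \<Lambda> :: "nat \<Rightarrow> real"
    and K :: "real^('N \<times> 'N)^'N"
    and P Pf :: "real^'N^'N"
    and \<delta> jb :: real
  defines "\<Phi> \<equiv> lift_map m xc yc \<alpha>"
    and "F \<equiv> stabilized_field m yc a b (quadratic_field A0 H0) \<Lambda>"
    and "A \<equiv> stabilized_A m yc A0 \<Lambda>"
    and "J \<equiv> J_matrix P Pf (stabilized_H m yc s H0 \<Lambda> + K)"
  assumes p_poly: "polynomial_function p"
    and p_zero: "p 0 = 0"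
    and p_hurwitz: "hurwitz (jacobian p (at 0))"
    and coords: "lift_coordinates m xc yc"
    and degree: "\<And>i. i < m \<Longrightarrow> (\<Sum>j\<in>UNIV. \<alpha> i j) \<ge> 2"
    and inner_quad: "inner_quadratic m xc yc \<alpha> a b"
    and extension: "\<And>x. quadratic_field A0 H0 (\<Phi> x) = jacobian \<Phi> (at x) *v p x"
    and s: "\<And>i w. i < m \<Longrightarrow> s i \<bullet> (w \<otimes>\<^sub>v w) = w $ a i * w $ b i"
    and gauge: "\<And>w. K *v (w \<otimes>\<^sub>v w) = 0"
    and P: "pos_def_matrix P"
    and Pf: "P = transpose Pf ** Pf"
    and A_bound: "spectral_norm (transpose A ** P + P ** A + mat 1) \<le> \<delta>"
    and \<delta>: "\<delta> < 1"
    and J_bound: "spectral_norm J \<le> jb"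
  shows "(\<forall>\<eta> \<rho>. 0 < \<eta> \<and> \<eta> < 1 \<and> 0 < jb \<and> \<rho> = (1 - \<eta>) * (1 - \<delta>) / jb \<longrightarrow>
            positively_invariant F {w. w \<bullet> (P *v w) \<le> \<rho>\<^sup>2} \<and>
            {w. w \<bullet> (P *v w) \<le> \<rho>\<^sup>2} \<subseteq> region_of_attraction F \<and>
            {x. \<Phi> x \<bullet> (P *v \<Phi> x) \<le> \<rho>\<^sup>2} \<subseteq> region_of_attraction p) \<and>
         (jb = 0 \<longrightarrow> global_lyapunov_function F (\<lambda>w. w \<bullet> (P *v w)))"
proof -
  define V where "V w = w \<bullet> (P *v w)" for w
  define DV where "DV w h = 2 * ((P *v w) \<bullet> h)" for w h
  have V: "(V has_derivative DV w) (at w)" for w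
    unfolding V_def DV_def using P by (intro quadratic_form_has_derivative) (simp add: pos_def_matrix_def)
  have F_eq: "F = quadratic_field A (stabilized_H m yc s H0 \<Lambda>)"
    unfolding F_def A_def by (rule stabilized_field_eq_quadratic_field[OF s])
  have "quadratic_field A (stabilized_H m yc s H0 \<Lambda> + K) = F"
    by (simp add: F_eq quadratic_field_def[abs_def] matrix_vector_mult_add_rdistrib gauge)
  hence LD: "DV w (F w) \<le> - ((1 - \<delta> - jb * sqrt (V w)) * (norm w)\<^sup>2)" for w
    using quadratic_field_lyapunov_derivative_le[OF P Pf A_bound J_bound[unfolded J_def], of w]
    by (simp add: V_def DV_def)
  have "global_lyapunov_function F V" if "jb = 0"
    unfolding global_lyapunov_function_def
  proof (intro conjI allI impI)
    show "pos_def_quadratic_form V"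
      unfolding pos_def_quadratic_form_def V_def[abs_def] using P by blast
    fix w :: "real^'N" assume "w \<noteq> 0"
    hence "0 < (1 - \<delta>) * (norm w)\<^sup>2" using \<delta> by simp
    hence "DV w (F w) < 0" using LD[of w] that by (simp add: algebra_simps)
    thus "frechet_derivative V (at w) (F w) < 0" using frechet_derivative_at[OF V] by metis
  qed
  moreover have "positively_invariant F {w. V w \<le> \<rho>\<^sup>2} \<and> {w. V w \<le> \<rho>\<^sup>2} \<subseteq> region_of_attraction F \<and>
      {x. V (\<Phi> x) \<le> \<rho>\<^sup>2} \<subseteq> region_of_attraction p"
    if \<eta>: "0 < \<eta>" "\<eta> < 1" and jb: "0 < jb" and \<rho>: "\<rho> = (1 - \<eta>) * (1 - \<delta>) / jb" for \<eta> \<rho>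
  proof -
    obtain \<beta> where \<beta>: "0 < \<beta>" "\<And>w. (norm w)\<^sup>2 \<le> \<beta> * V w"
      using norm_le_pos_def[OF P Pf] unfolding V_def by blast
    obtain \<gamma> where \<gamma>: "0 < \<gamma>" "\<And>w. V w \<le> \<gamma> * (norm w)\<^sup>2"
      using pos_def_le_norm[OF P Pf] unfolding V_def by blast
    \<comment> \<open>The decay gives \<open>- \<eta> (1 - \<delta>) (norm w)\<^sup>2\<close>; dividing by \<open>\<gamma>\<close> converts it into a rate for \<open>V\<close>.\<close>
    define c where "c = \<eta> * (1 - \<delta>) / \<gamma>"
    have c: "0 < c" using \<eta> \<delta> \<gamma> by (simp add: c_def)
    \<comment> \<open>The level up to which \<open>V\<close> is nonincreasing.\<close>
    define \<rho>' where "\<rho>' = (1 - \<delta>) / jb"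
    have \<rho>_less: "0 < \<rho>" "\<rho> < \<rho>'" using \<eta> \<delta> jb by (simp_all add: \<rho> \<rho>'_def divide_strict_right_mono)
    have sublevel: "jb * sqrt (V w) \<le> jb * R" if "V w \<le> R\<^sup>2" "0 < R" for w R
      using that jb by (intro mult_left_mono real_le_lsqrt) auto
    have decrease: "DV w (F w) \<le> 0" if "V w \<le> \<rho>'\<^sup>2" for w
    proof -
      have "0 \<le> (1 - \<delta> - jb * sqrt (V w)) * (norm w)\<^sup>2"
        using sublevel[OF that] \<rho>_less jb by (intro mult_nonneg_nonneg) (auto simp: \<rho>'_def)
      thus ?thesis using LD[of w] by linarith
    qed
    have decay: "DV w (F w) \<le> - c * V w" if "V w \<le> \<rho>\<^sup>2" for w
    proof -
      have "\<eta> * (1 - \<delta>) \<le> 1 - \<delta> - jb * sqrt (V w)"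
      proof -
        have "jb * \<rho> = (1 - \<eta>) * (1 - \<delta>)" using jb by (simp add: \<rho>)
        thus ?thesis using sublevel[OF that \<rho>_less(1)] by (simp add: left_diff_distrib)
      qed
      hence "\<eta> * (1 - \<delta>) * (norm w)\<^sup>2 \<le> (1 - \<delta> - jb * sqrt (V w)) * (norm w)\<^sup>2"
        by (rule mult_right_mono) simp
      moreover have "c * V w \<le> c * (\<gamma> * (norm w)\<^sup>2)" using \<gamma>(2) c by (intro mult_left_mono) auto
      moreover have "c * (\<gamma> * (norm w)\<^sup>2) = \<eta> * (1 - \<delta>) * (norm w)\<^sup>2" using \<gamma>(1) by (simp add: c_def)
      ultimately show ?thesis using LD[of w] by linarith
    qed
    have levels: "\<rho>\<^sup>2 < \<rho>'\<^sup>2" using \<rho>_less by (intro power_strict_mono) auto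
    have invariant: "positively_invariant F {w. V w \<le> \<rho>\<^sup>2}"
      by (rule sublevel_set_positively_invariant[OF V decrease levels])
    have "{w. V w \<le> \<rho>\<^sup>2} \<subseteq> region_of_attraction F"
    proof (rule pullback_sublevel_set_subset_region_of_attraction[OF V \<beta>(2,1) decay c invariant])
      show "\<exists>L. L-lipschitz_on (cball 0 R) F" for R
        unfolding F_eq by (intro polynomial_function_lipschitz_on_cball polynomial_function_quadratic_field)
      show "((\<lambda>w. w) has_derivative (\<lambda>h. h)) (at w)" for w :: "real^'N" by (rule has_derivative_ident)
    qed auto
    moreover have "{x. V (\<Phi> x) \<le> \<rho>\<^sup>2} \<subseteq> region_of_attraction p"
    proof (rule pullback_sublevel_set_subset_region_of_attraction[OF V \<beta>(2,1) decay c invariant])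
      show "\<exists>L. L-lipschitz_on (cball 0 R) p" for R
        using p_poly by (rule polynomial_function_lipschitz_on_cball)
      show "(\<Phi> has_derivative (\<lambda>h. jacobian \<Phi> (at x) *v h)) (at x)" for x
        unfolding \<Phi>_def by (rule lift_map_has_derivative)
      show "jacobian \<Phi> (at x) *v p x = F (\<Phi> x)" for x
        using extension[of x] stabilized_field_lift_map[OF coords inner_quad] by (simp add: F_def \<Phi>_def)
      show "norm x \<le> norm (\<Phi> x)" for x
        unfolding \<Phi>_def by (rule norm_le_norm_lift_map[OF coords])
    qed auto
    ultimately show ?thesis using invariant by blast
  qed
  ultimately show ?thesis unfolding V_def[abs_def] by blast
qed

end
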